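(* Let $X$ be a Banach space, let $\alpha\in\mathbb{C}$ with $\operatorname{Re}\alpha>0$, and let $T$ be a power-bounded bounded linear operator on $X$, with $C_T=\sup_{n\ge0}\Vert T^n\Vert<\infty$. (i) The operator $(I-T)^\alpha$ is bounded and $$\Vert(I-T)^\alpha\Vert\le C_T\Vert k^{-\alpha}\Vert_1\le c_\alpha C_T.$$ (ii) The entire group $(e^{-t(I-T)^\alpha})_{t\in\mathbb{C}}$ satisfies $$e^{-t(I-T)^\alpha}=e^{-t}\sum_{n=0}^\infty p_{n;\alpha}(t)T^n,\qquad \operatorname{Re}\alpha>0,$$ and $\Vert e^{t(I-T)^\alpha}\Vert\le C_T\,e^{(c_\alpha+1)|t|}$ for $t\in\mathbb{C}$.
   Context: The Cesàro numbers are $k^\alpha(0)=1$, $k^\alpha(n)=\frac{\alpha(\alpha+1)\cdots(\alpha+n-1)}{n!}$ for $n\ge1$, $\alpha\in\mathbb{C}$; $\Vert f\Vert_1=\sum_{n\ge0}|f(n)|$ for a complex sequence $f$; the sequence $k^{-\alpha}$ is absolutely summable when $\operatorname{Re}\alpha>0$. $I$ is the identity operator on $X$. For $T$ power-bounded and $\operatorname{Re}\alpha>0$, the fractional power is $(I-T)^\alpha:=\sum_{n=0}^\infty k^{-\alpha}(n)T^n$, with $T^0=I$. For a bounded operator $A$, $e^{A}=\sum_{j\ge0}A^j/j!$. The falling factorial is $(z)_n=z(z-1)\cdots(z-n+1)$ for $n\ge1$. For $a\in\mathbb{C}$, the array $(b_{j,n;a})_{n\ge1,\,1\le j\le n}$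 is defined by $b_{1,n;a}=(a)_n$, $b_{n,n;a}=a^n$ for $n\ge1$, and $b_{j,n+1;a}=(aj-n)b_{j,n;a}+a\,b_{j-1,n;a}$ for $2\le j\le n$. The polynomials $p_{n;a}$ are $p_{0;a}(t)=1$ and $p_{n;a}(t)=\frac{(-1)^n}{n!}\sum_{l=1}^n b_{l,n;a}(-t)^l$ for $n\ge1$. For $\operatorname{Re}\alpha>0$, $$c_\alpha=2^{[\operatorname{Re}\alpha]+1}\,\frac{|\alpha-[\operatorname{Re}\alpha]|}{\operatorname{Re}\alpha-[\operatorname{Re}\alpha]}\,\frac{\Gamma\bigl(1-(\operatorname{Re}\alpha-[\operatorname{Re}\alpha])\bigr)}{\bigl|\Gamma\bigl(1-(\alpha-[\operatorname{Re}\alpha])\bigr)\bigr|},$$ where $[x]$ is the integer part of a real number $x$ and $\Gamma$ is the Euler Gamma function.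
   Formalization: When Re α is an integer the formula for c_α divides by zero: for natural α the quotient 0/0 is read as 1, so c_α = 2^{α+1}; for Im α ≠ 0, c_α is taken as infinite, so the bounds involving c_α say nothing there. *)

theory Defs
  imports "HOL-Analysis.Analysis"
begin

text \<open>HOL-Analysis only has real normed spaces, so complex Banach spaces are introduced as real
  Banach spaces with a compatible complex scalar multiplication.\<close>

class complex_banach = banach +
  fixes scaleC :: "complex \<Rightarrow> 'a \<Rightarrow> 'a" (infixr \<open>*\<^sub>C\<close> 75)
  assumes scaleC_add_right: "c *\<^sub>C (x + y) = c *\<^sub>C x + c *\<^sub>C y"
    and scaleC_add_left: "(c + d) *\<^sub>C x = c *\<^sub>C x + d *\<^sub>C x"
    and scaleC_scaleC: "c *\<^sub>C d *\<^sub>C x = (c * d) *\<^sub>C x"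
    and scaleC_of_real: "complex_of_real r *\<^sub>C x = r *\<^sub>R x"
    and norm_scaleC: "norm (c *\<^sub>C x) = cmod c * norm x"

instantiation complex :: complex_banach
begin
definition scaleC_complex :: "complex \<Rightarrow> complex \<Rightarrow> complex"
  where "scaleC_complex c z = c * z"
instance
  by standard (simp_all add: scaleC_complex_def algebra_simps norm_mult scaleR_conv_of_real)
end

lemma bounded_linear_scaleC: "bounded_linear (\<lambda>x::'a::complex_banach. c *\<^sub>C x)"
proof (rule bounded_linear_intro[where K = "cmod c"])
  fix r :: real and x y :: 'a
  show "c *\<^sub>C (x + y) = c *\<^sub>C x + c *\<^sub>C y" by (rule scaleC_add_right)
  show "c *\<^sub>C r *\<^sub>R x = r *\<^sub>R c *\<^sub>C x"
    by (simp add: scaleC_of_real[symmetric] scaleC_scaleC mult.commute)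
  show "norm (c *\<^sub>C x) \<le> norm x * cmod c" by (simp add: norm_scaleC)
qed

text \<open>Real-linear bounded operators into a complex Banach space form a complex Banach space under
  the operator norm; complex linearity of an operator is a separate predicate below.\<close>

instantiation blinfun :: (real_normed_vector, complex_banach) complex_banach
begin
lift_definition scaleC_blinfun :: "complex \<Rightarrow> ('a \<Rightarrow>\<^sub>L 'b) \<Rightarrow> ('a \<Rightarrow>\<^sub>L 'b)"
  is "\<lambda>c f x. c *\<^sub>C f x"
  by (rule bounded_linear_compose[OF bounded_linear_scaleC])
instance
proof
  fix c d :: complex and r :: real and f g :: "'a \<Rightarrow>\<^sub>L 'b"
  show "c *\<^sub>C (f + g) = c *\<^sub>C f + c *\<^sub>C g"
    by transfer (simp add: scaleC_add_right)
  show "(c + d) *\<^sub>C f = c *\<^sub>C f + d *\<^sub>C f"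
    by transfer (simp add: scaleC_add_left)
  show "c *\<^sub>C d *\<^sub>C f = (c * d) *\<^sub>C f"
    by transfer (simp add: scaleC_scaleC)
  show "complex_of_real r *\<^sub>C f = r *\<^sub>R f"
    by transfer (simp add: scaleC_of_real)
  have le: "norm (a *\<^sub>C h) \<le> cmod a * norm h" for a and h :: "'a \<Rightarrow>\<^sub>L 'b"
  proof (rule norm_blinfun_bound)
    fix x
    show "norm (blinfun_apply (a *\<^sub>C h) x) \<le> cmod a * norm h * norm x"
      using norm_blinfun[of h x]
      by (simp add: scaleC_blinfun.rep_eq norm_scaleC mult.assoc mult_left_mono)
  qed simp
  show "norm (c *\<^sub>C f) = cmod c * norm f"
  proof (cases "c = 0")
    case True
    then show ?thesis using le[of c f] by simp
  next
    case False
    have "f = inverse c *\<^sub>C c *\<^sub>C f"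
      using False by transfer (simp add: scaleC_scaleC scaleC_of_real[of 1, simplified])
    then have "norm f \<le> inverse (cmod c) * norm (c *\<^sub>C f)"
      using le[of "inverse c" "c *\<^sub>C f"] by (simp add: norm_inverse)
    then have "cmod c * norm f \<le> norm (c *\<^sub>C f)"
      using False by (simp add: field_simps)
    then show ?thesis using le[of c f] by simp
  qed
qed
end

definition bounded_clinear :: "('a::complex_banach \<Rightarrow> 'b::complex_banach) \<Rightarrow> bool"
  where "bounded_clinear f \<longleftrightarrow> bounded_linear f \<and> (\<forall>c x. f (c *\<^sub>C x) = c *\<^sub>C f x)"

primrec op_pow :: "('a::complex_banach \<Rightarrow>\<^sub>L 'a) \<Rightarrow> nat \<Rightarrow> ('a \<Rightarrow>\<^sub>L 'a)"
  where
    "op_pow T 0 = id_blinfun"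
  | "op_pow T (Suc n) = T o\<^sub>L op_pow T n"

definition power_bounded :: "('a::complex_banach \<Rightarrow>\<^sub>L 'a) \<Rightarrow> bool"
  where "power_bounded T \<longleftrightarrow> bdd_above (range (\<lambda>n. norm (op_pow T n)))"

definition power_bound :: "('a::complex_banach \<Rightarrow>\<^sub>L 'a) \<Rightarrow> real"
  where "power_bound T = (SUP n. norm (op_pow T n))"

definition op_exp :: "('a::complex_banach \<Rightarrow>\<^sub>L 'a) \<Rightarrow> ('a \<Rightarrow>\<^sub>L 'a)"
  where "op_exp A = (\<Sum>j. (1 / fact j) *\<^sub>R op_pow A j)"

definition entire_group :: "(complex \<Rightarrow> ('a::complex_banach \<Rightarrow>\<^sub>L 'a)) \<Rightarrow> bool"
  where "entire_group U \<longleftrightarrow>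
    U 0 = id_blinfun \<and> (\<forall>s t. U (s + t) = U s o\<^sub>L U t) \<and>
    (\<forall>t. \<exists>D. ((\<lambda>h. (1 / h) *\<^sub>C (U (t + h) - U t)) \<longlongrightarrow> D) (at 0))"

definition cesaro :: "complex \<Rightarrow> nat \<Rightarrow> complex"
  where "cesaro \<alpha> n = pochhammer \<alpha> n / fact n"

definition l1_norm :: "(nat \<Rightarrow> complex) \<Rightarrow> real"
  where "l1_norm f = (\<Sum>n. cmod (f n))"

text \<open>The operator \<open>(I - T)\<^sup>\<alpha>\<close>; the series is taken in the operator norm.\<close>

definition frac_pow_id_minus :: "('a::complex_banach \<Rightarrow>\<^sub>L 'a) \<Rightarrow> complex \<Rightarrow> ('a \<Rightarrow>\<^sub>L 'a)"
  where "frac_pow_id_minus T \<alpha> = (\<Sum>n. cesaro (- \<alpha>) n *\<^sub>C op_pow T n)"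

definition falling_fact :: "complex \<Rightarrow> nat \<Rightarrow> complex"
  where "falling_fact z n = (\<Prod>i<n. z - of_nat i)"

text \<open>\<open>b_coeff a j n\<close> is \<open>b\<^bsub>j,n;a\<^esub>\<close>; it is set to 0 outside \<open>1 \<le> j \<le> n\<close>.\<close>

fun b_coeff :: "complex \<Rightarrow> nat \<Rightarrow> nat \<Rightarrow> complex"
  where
    "b_coeff a j 0 = 0"
  | "b_coeff a j (Suc n) =
      (if j = 1 then falling_fact a (Suc n)
       else if j = Suc n then a ^ Suc n
       else if 2 \<le> j \<and> j \<le> n
         then (a * of_nat j - of_nat n) * b_coeff a j n + a * b_coeff a (j - 1) n
       else 0)"

definition p_poly :: "complex \<Rightarrow> nat \<Rightarrow> complex \<Rightarrow> complex"
  where "p_poly a n t =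
    (if n = 0 then 1
     else (- 1) ^ n / fact n * (\<Sum>l = 1..n. b_coeff a l n * (- t) ^ l))"

text \<open>The constant \<open>c\<^sub>\<alpha>\<close>, written with \<open>\<beta> = \<alpha> - [Re \<alpha>]\<close>. The factor \<open>|\<beta>| / Re \<beta>\<close> degenerates when
  \<open>Re \<alpha>\<close> is an integer: it is \<open>\<infinity>\<close> (the value of this division in \<^typ>\<open>ereal\<close>) if \<open>Im \<alpha> \<noteq> 0\<close>,
  and the indeterminate \<open>0 / 0\<close>, occurring for \<open>\<alpha> \<in> \<nat>\<close>, is read as 1, its constant value for
  real \<open>\<beta> > 0\<close>. Since \<open>0 < Re (1 - \<beta>) \<le> 1\<close>, no pole of the Gamma function is met.\<close>

definition c_const :: "complex \<Rightarrow> ereal"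
  where "c_const \<alpha> =
    (let m = \<lfloor>Re \<alpha>\<rfloor>; \<beta> = \<alpha> - of_int m in
       ereal (2 powi (m + 1))
       * (if \<beta> = 0 then 1 else ereal (cmod \<beta>) / ereal (Re \<beta>))
       * ereal (Gamma (1 - Re \<beta>) / cmod (Gamma (1 - \<beta>))))"

end

theory Submission
  imports Defs
begin

text \<open>Write \<open>k\<^bsup>-\<alpha>\<^esup>\<close> for the sequence \<open>cesaro (- \<alpha>)\<close>, the coefficients of \<open>(1 - z)\<^sup>\<alpha>\<close>. Everything takes place in
  the algebra of absolutely summable sequences under convolution, which acts on the space through
  \<open>f \<mapsto> \<Sum>n. f n *\<^sub>C op_pow T n\<close>. This map is multiplicative (\<open>op_series_convolution\<close>) and has norm at
  most \<open>power_bound T\<close> (\<open>norm_suminf_scaleC_le\<close>).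

  For (i) it remains to bound the \<open>\<ell>\<^sup>1\<close> norm of \<open>k\<^bsup>-\<alpha>\<^esup>\<close>. Lowering the exponent by the integer part of
  \<open>Re \<alpha>\<close> costs a factor 2 per step, because a unit of exponent is a first difference. If the
  exponent \<open>\<beta>\<close> that is left has \<open>0 < Re \<beta> < 1\<close>, then \<open>\<bar>k\<^bsup>-\<beta>\<^esup>(n)\<bar>\<close> for \<open>n \<ge> 1\<close> is compared with its value at the
  real exponent \<open>Re \<beta>\<close>: the quotient increases with \<open>n\<close> to a limit given by the Gamma function
  (\<open>cmod_pochhammer_le_Gamma_ratio\<close>), and the real sequence telescopes
  (\<open>l1_norm_cesaro_le_Gamma\<close>, \<open>l1_norm_cesaro_le_c_const\<close>).

  For (ii), convolution adds exponents, so the \<open>j\<close>-th power of \<open>(I - T)\<^sup>\<alpha>\<close> has the coefficients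
  \<open>k\<^bsup>-j\<alpha>\<^esup>\<close>, whose norm is at most the \<open>j\<close>-th power of that of \<open>k\<^bsup>-\<alpha>\<^esup>\<close>. Summing the exponential series
  gives \<open>power_bound T * exp (cmod t * l1_norm (cesaro (- \<alpha>)))\<close> as a bound for the exponential, and
  interchanging the two sums identifies the coefficient of \<open>T\<^sup>n\<close> as
  \<open>\<Sum>j. (- t) ^ j / fact j * k\<^bsup>-j\<alpha>\<^esup>(n)\<close>. Here \<open>k\<^bsup>-j\<alpha>\<^esup>(n)\<close> is, up to a factor depending on \<open>n\<close>
  only, the falling factorial \<open>(j \<alpha>)\<^sub>n\<close>. Its coordinates with respect to the falling factorials of \<open>j\<close>
  are exactly the array \<open>b\<^bsub>l,n;\<alpha>\<^esub>\<close> (\<open>falling_fact_mult_expansion\<close>), and each \<open>(j)\<^sub>l\<close> sums to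
  \<open>(- t) ^ l * exp (- t)\<close>, so the coefficient is \<open>exp (- t) * p\<^bsub>n;\<alpha>\<^esub>(t)\<close> (\<open>p_poly_exp_series\<close>).\<close>

section \<open>Products and double series in Banach spaces\<close>

text \<open>The doubly indexed family \<open>prod (f i) (g j)\<close> is absolutely summable, so its sum may be taken
  row by row, which gives the right-hand side, or along the antidiagonals \<open>i + j = n\<close>. The product
  is a bilinear map rather than a ring multiplication because bounded operators on a possibly
  trivial space do not form a normed algebra with \<open>norm 1 = 1\<close>.\<close>

lemma Cauchy_product_bounded_bilinear:
  fixes f :: "nat \<Rightarrow> 'a::banach" and g :: "nat \<Rightarrow> 'b::banach"
    and prod :: "'a \<Rightarrow> 'b \<Rightarrow> 'c::banach"
  assumes "bounded_bilinear prod"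
    and f: "summable (\<lambda>n. norm (f n))" and g: "summable (\<lambda>n. norm (g n))"
  shows "(\<lambda>n. \<Sum>i\<le>n. prod (f i) (g (n - i))) sums prod (suminf f) (suminf g)"
proof -
  interpret bounded_bilinear prod by fact
  obtain K where K: "K \<ge> 0" "\<And>a b. norm (prod a b) \<le> norm a * norm b * K"
    using nonneg_bounded by blast
  have F: "(f has_sum suminf f) UNIV" "(g has_sum suminf g) UNIV"
    using f g by (auto intro!: norm_summable_imp_has_sum summable_sums intro: summable_norm_cancel)
  have sF: "(\<lambda>n. norm (f n)) summable_on UNIV" and sG: "(\<lambda>n. norm (g n)) summable_on UNIV"
    using f g by (auto intro!: norm_summable_imp_summable_on)
  have "(\<lambda>(i, j). norm (f i) * (norm (g j) * K)) summable_on UNIV \<times> UNIV"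
  proof (rule summable_on_SigmaI)
    show "((\<lambda>j. case (i, j) of (i, j) \<Rightarrow> norm (f i) * (norm (g j) * K))
        has_sum norm (f i) * ((\<Sum>\<^sub>\<infinity>j. norm (g j)) * K)) UNIV" for i
      using sG by (auto intro!: has_sum_cmult_right has_sum_cmult_left)
    show "(\<lambda>i. norm (f i) * ((\<Sum>\<^sub>\<infinity>j. norm (g j)) * K)) summable_on UNIV"
      by (intro summable_on_cmult_left sF)
  qed (use K in auto)
  then have "(\<lambda>(i, j). prod (f i) (g j)) abs_summable_on UNIV \<times> UNIV"
    by (rule Infinite_Sum.abs_summable_on_comparison_test') (use K in \<open>auto simp: mult.assoc\<close>)
  then have abs: "(\<lambda>(i, j). prod (f i) (g j)) summable_on UNIV \<times> UNIV"
    by (rule abs_summable_summable)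
  have "infsum (\<lambda>(i, j). prod (f i) (g j)) (UNIV \<times> UNIV)
      = (\<Sum>\<^sub>\<infinity>i. \<Sum>\<^sub>\<infinity>j. prod (f i) (g j))"
    using infsum_Sigma'_banach[OF abs] by simp
  also have "\<dots> = (\<Sum>\<^sub>\<infinity>i. prod (f i) (suminf g))"
    by (intro infsum_cong infsumI has_sum_bounded_linear[OF bounded_linear_right F(2), unfolded o_def])
  also have "\<dots> = prod (suminf f) (suminf g)"
    by (intro infsumI has_sum_bounded_linear[OF bounded_linear_left F(1), unfolded o_def])
  finally have "((\<lambda>(i, j). prod (f i) (g j)) has_sum prod (suminf f) (suminf g)) (UNIV \<times> UNIV)"
    using abs has_sum_infsum by fastforce
  moreover have "bij_betw (\<lambda>(n, i). (i, n - i)) (Sigma UNIV (\<lambda>n::nat. {..n})) (UNIV \<times> UNIV)"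
    by (rule bij_betwI[where g = "\<lambda>(i, j). (i + j, i)"]) auto
  ultimately have "((\<lambda>(n, i). prod (f i) (g (n - i))) has_sum prod (suminf f) (suminf g))
      (Sigma UNIV (\<lambda>n::nat. {..n}))"
    by (subst (asm) has_sum_reindex_bij_betw[symmetric]) (auto simp: case_prod_unfold)
  then have "((\<lambda>n. \<Sum>i\<le>n. prod (f i) (g (n - i))) has_sum prod (suminf f) (suminf g)) UNIV"
    by (rule has_sum_SigmaD) (auto intro: has_sum_finite)
  then show ?thesis by (rule has_sum_imp_sums)
qed

lemma suminf_swap:
  fixes F :: "nat \<Rightarrow> nat \<Rightarrow> 'a::banach"
  assumes inner: "\<And>j. summable (\<lambda>n. norm (F j n))"
    and outer: "summable (\<lambda>j. \<Sum>n. norm (F j n))"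
  shows "summable (\<lambda>n. \<Sum>j. F j n)" and "(\<Sum>j. \<Sum>n. F j n) = (\<Sum>n. \<Sum>j. F j n)"
proof -
  have infsum_suminf: "infsum g UNIV = suminf g" if "g summable_on UNIV" for g :: "nat \<Rightarrow> 'a"
    using that has_sum_imp_sums has_sum_infsum sums_unique by metis
  have abs: "(\<lambda>(j, n). F j n) abs_summable_on UNIV \<times> UNIV"
  proof (rule summable_on_SigmaI)
    show "((\<lambda>n. norm (case (j, n) of (j, n) \<Rightarrow> F j n)) has_sum (\<Sum>n. norm (F j n))) UNIV" for j
      using inner[of j] by (auto intro!: norm_summable_imp_has_sum)
    show "(\<lambda>j. \<Sum>n. norm (F j n)) summable_on UNIV"
      using outer inner by (subst summable_on_UNIV_nonneg_real_iff) (auto intro: suminf_nonneg)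
  qed simp
  then have abs': "(\<lambda>(n, j). F j n) abs_summable_on UNIV \<times> UNIV"
    using summable_on_swap[of "\<lambda>(j, n). norm (F j n)" UNIV UNIV] by (simp add: case_prod_unfold)
  note F = abs_summable_summable[OF abs] and F' = abs_summable_summable[OF abs']
  have row: "F j summable_on UNIV" and col: "(\<lambda>j. F j n) summable_on UNIV" for j n
    using abs abs' unfolding Infinite_Sum.abs_summable_on_Sigma_iff by (auto intro: abs_summable_summable)
  have rows: "(\<lambda>j. \<Sum>\<^sub>\<infinity>n. F j n) summable_on UNIV" and cols: "(\<lambda>n. \<Sum>\<^sub>\<infinity>j. F j n) summable_on UNIV"
    using summable_on_Sigma_banach[OF F] summable_on_Sigma_banach[OF F'] by auto
  show "summable (\<lambda>n. \<Sum>j. F j n)"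
    using summable_on_imp_summable[OF cols] by (simp add: infsum_suminf[OF col])
  show "(\<Sum>j. \<Sum>n. F j n) = (\<Sum>n. \<Sum>j. F j n)"
    using infsum_swap_banach[OF F] infsum_suminf[OF rows] infsum_suminf[OF cols]
    by (simp add: infsum_suminf[OF row] infsum_suminf[OF col])
qed

section \<open>Complex scalars and powers of operators\<close>

lemma bounded_bilinear_scaleC:
  "bounded_bilinear (scaleC :: complex \<Rightarrow> 'a::complex_banach \<Rightarrow> 'a)"
proof
  fix r :: real and a b :: complex and x y :: 'a
  show "(a + b) *\<^sub>C x = a *\<^sub>C x + b *\<^sub>C x" by (rule scaleC_add_left)
  show "a *\<^sub>C (x + y) = a *\<^sub>C x + a *\<^sub>C y" by (rule scaleC_add_right)
  show "(r *\<^sub>R a) *\<^sub>C x = r *\<^sub>R a *\<^sub>C x"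
    by (simp add: scaleR_conv_of_real scaleC_scaleC[symmetric] scaleC_of_real)
  show "a *\<^sub>C r *\<^sub>R x = r *\<^sub>R a *\<^sub>C x"
    by (simp add: scaleC_of_real[symmetric] scaleC_scaleC mult.commute)
  show "\<exists>K. \<forall>a x. norm (a *\<^sub>C (x::'a)) \<le> norm a * norm x * K"
    by (intro exI[of _ 1]) (simp add: norm_scaleC)
qed

lemmas scaleC_zero_left [simp] = bounded_bilinear.zero_left[OF bounded_bilinear_scaleC]
  and scaleC_minus_left = bounded_bilinear.minus_left[OF bounded_bilinear_scaleC]
  and scaleC_sum_left = bounded_bilinear.sum_left[OF bounded_bilinear_scaleC]
  and bounded_linear_scaleC_left = bounded_bilinear.bounded_linear_left[OF bounded_bilinear_scaleC]

lemma scaleC_one [simp]: "1 *\<^sub>C (x::'a::complex_banach) = x"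
  using scaleC_of_real[of 1 x] by simp

lemma summable_scaleC_bounded:
  fixes x :: "nat \<Rightarrow> 'a::complex_banach"
  assumes "summable (\<lambda>n. cmod (f n))" and "\<And>n. norm (x n) \<le> C"
  shows "summable (\<lambda>n. norm (f n *\<^sub>C x n))"
  by (rule summable_comparison_test'[of "\<lambda>n. cmod (f n) * C" 0])
    (use assms in \<open>auto simp: norm_scaleC intro: summable_mult2 mult_left_mono\<close>)

text \<open>With \<open>x n = op_pow T n\<close> and \<open>C\<close> a bound for the powers of \<open>T\<close>, this says that inserting \<open>T\<close>
  into a power series with absolutely summable coefficients costs at most the factor \<open>C\<close>.\<close>

lemma norm_suminf_scaleC_le:
  fixes x :: "nat \<Rightarrow> 'a::complex_banach"
  assumes "summable (\<lambda>n. cmod (f n))" and "\<And>n. norm (x n) \<le> C"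
  shows "norm (\<Sum>n. f n *\<^sub>C x n) \<le> C * l1_norm f"
proof -
  have "norm (\<Sum>n. f n *\<^sub>C x n) \<le> (\<Sum>n. norm (f n *\<^sub>C x n))"
    by (intro summable_norm summable_scaleC_bounded[OF assms])
  also have "\<dots> \<le> (\<Sum>n. C * cmod (f n))"
    by (intro suminf_le summable_scaleC_bounded[OF assms] summable_mult assms)
      (use assms(2) in \<open>auto simp: norm_scaleC mult.commute[of C] intro: mult_left_mono\<close>)
  also have "\<dots> = C * l1_norm f"
    using assms(1) by (simp add: l1_norm_def suminf_mult)
  finally show ?thesis .
qed

lemma blinfun_compose_scaleC_left: "(c *\<^sub>C F) o\<^sub>L G = c *\<^sub>C (F o\<^sub>L G)"
  by (rule blinfun_eqI) (simp add: scaleC_blinfun.rep_eq)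

lemma id_blinfun_compose: "id_blinfun o\<^sub>L F = F"
  by (rule blinfun_eqI) simp

lemma compose_id_blinfun: "F o\<^sub>L id_blinfun = F"
  by (rule blinfun_eqI) simp

lemma blinfun_compose_scaleC_right:
  assumes "bounded_clinear (blinfun_apply F)"
  shows "F o\<^sub>L (c *\<^sub>C G) = c *\<^sub>C (F o\<^sub>L G)"
  using assms by (intro blinfun_eqI) (simp add: scaleC_blinfun.rep_eq bounded_clinear_def)

lemma op_pow_add: "op_pow F (m + n) = op_pow F m o\<^sub>L op_pow F n"
  by (induction m) (auto simp: blinfun_eqI)

lemma norm_op_pow_le: "norm (op_pow F n) \<le> norm F ^ n"
proof (induction n)
  case 0
  show ?case by (simp add: norm_blinfun_id_le)
next
  case (Suc n)
  then have "norm F * norm (op_pow F n) \<le> norm F * norm F ^ n"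
    by (intro mult_left_mono) auto
  then show ?case
    using norm_blinfun_compose[of F "op_pow F n"] by simp
qed

lemma bounded_clinear_op_pow:
  assumes "bounded_clinear (blinfun_apply F)"
  shows "bounded_clinear (blinfun_apply (op_pow F n))"
  using assms by (induction n) (auto simp: bounded_clinear_def blinfun.bounded_linear_right)

lemma op_pow_scaleC:
  assumes "bounded_clinear (blinfun_apply F)"
  shows "op_pow (c *\<^sub>C F) n = c ^ n *\<^sub>C op_pow F n"
  by (induction n)
    (simp_all add: blinfun_compose_scaleC_left blinfun_compose_scaleC_right assms scaleC_scaleC)

lemma bounded_clinear_suminf:
  fixes f :: "nat \<Rightarrow> 'a::complex_banach \<Rightarrow>\<^sub>L 'b::complex_banach"
  assumes "summable f" and "\<And>n. bounded_clinear (blinfun_apply (f n))"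
  shows "bounded_clinear (blinfun_apply (suminf f))"
  unfolding bounded_clinear_def
proof (intro conjI allI)
  fix c :: complex and x :: 'a
  have app: "(\<lambda>n. f n y) sums suminf f y" for y
    using assms(1) bounded_linear.sums[OF blinfun.bounded_linear_left] summable_sums by blast
  have "(\<lambda>n. c *\<^sub>C f n x) sums (c *\<^sub>C suminf f x)"
    by (rule bounded_linear.sums[OF bounded_linear_scaleC app])
  moreover have "(\<lambda>n. c *\<^sub>C f n x) sums suminf f (c *\<^sub>C x)"
    using app[of "c *\<^sub>C x"] assms(2) by (simp add: bounded_clinear_def)
  ultimately show "suminf f (c *\<^sub>C x) = c *\<^sub>C suminf f x"
    by (metis sums_unique2)
qed (rule blinfun.bounded_linear_right)

lemma power_bounded_norm_op_pow_le:
  assumes "power_bounded T"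
  shows "norm (op_pow T n) \<le> power_bound T"
  using assms unfolding power_bounded_def power_bound_def by (intro cSUP_upper) auto

text \<open>The functional calculus \<open>f \<mapsto> \<Sum>n. f n *\<^sub>C op_pow T n\<close> is multiplicative: it turns convolution of
  coefficients into composition of operators. Complex linearity of \<open>T\<close> lets the scalars of the
  second factor pass through the powers of the first.\<close>

lemma op_series_convolution:
  fixes T :: "'a::complex_banach \<Rightarrow>\<^sub>L 'a"
  assumes T: "bounded_clinear (blinfun_apply T)"
    and f: "summable (\<lambda>n. norm (f n *\<^sub>C op_pow T n))"
    and g: "summable (\<lambda>n. norm (g n *\<^sub>C op_pow T n))"
  shows "(\<lambda>n. (\<Sum>i\<le>n. f i * g (n - i)) *\<^sub>C op_pow T n) sums
    ((\<Sum>n. f n *\<^sub>C op_pow T n) o\<^sub>L (\<Sum>n. g n *\<^sub>C op_pow T n))"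
proof -
  have "(\<Sum>i\<le>n. (f i *\<^sub>C op_pow T i) o\<^sub>L (g (n - i) *\<^sub>C op_pow T (n - i)))
      = (\<Sum>i\<le>n. f i * g (n - i)) *\<^sub>C op_pow T n" for n
  proof -
    have "(f i *\<^sub>C op_pow T i) o\<^sub>L (g (n - i) *\<^sub>C op_pow T (n - i))
        = (f i * g (n - i)) *\<^sub>C op_pow T n" if "i \<le> n" for i
      using that op_pow_add[of T i "n - i"]
      by (simp add: blinfun_compose_scaleC_left blinfun_compose_scaleC_right scaleC_scaleC
          bounded_clinear_op_pow[OF T])
    then show ?thesis by (simp add: scaleC_sum_left)
  qed
  then show ?thesis
    using Cauchy_product_bounded_bilinear[OF bounded_bilinear_blinfun_compose f g] by simp
qed

section \<open>Cesaro numbers\<close>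

lemma cesaro_0_right [simp]: "cesaro a 0 = 1"
  by (simp add: cesaro_def)

lemma cesaro_0_left: "cesaro 0 n = (if n = 0 then 1 else 0)"
  by (simp add: cesaro_def pochhammer_0_left)

text \<open>The Cesaro numbers are the coefficients of \<open>(1 - z) powr - a\<close>, so convolution adds the
  exponents; in coefficients this is Vandermonde's identity.\<close>

lemma cesaro_convolution: "(\<Sum>i\<le>n. cesaro a i * cesaro b (n - i)) = cesaro (a + b) n"
  unfolding cesaro_def pochhammer_binomial_sum sum_divide_distrib
  by (intro sum.cong refl) (simp add: binomial_fact field_simps)

text \<open>Multiplication of the generating function by \<open>1 - z\<close>.\<close>

lemma cesaro_diff: "cesaro (a - 1) (Suc n) = cesaro a (Suc n) - cesaro a n"
proof -
  have "pochhammer (a - 1) (Suc n) = (a - 1) * pochhammer a n"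
    by (simp add: pochhammer_rec)
  moreover have "pochhammer a n / fact n = of_nat (Suc n) * pochhammer a n / fact (Suc n)"
    by (simp del: of_nat_Suc)
  ultimately show ?thesis
    unfolding cesaro_def by (simp add: pochhammer_Suc diff_divide_distrib[symmetric] algebra_simps
        del: fact_Suc)
qed

lemma summable_cesaro_Suc_iff:
  "summable (\<lambda>n. cmod (cesaro a (Suc n))) \<longleftrightarrow> summable (\<lambda>n. cmod (cesaro a n))"
  by (rule summable_Suc_iff)

text \<open>The Gauss product for \<open>1 / Gamma (- \<alpha>)\<close> converges, hence is bounded; this gives the decay
  \<open>O(n powr (- Re \<alpha> - 1))\<close>, which is summable. The argument covers all \<open>\<alpha>\<close> at once, including
  those with integral real part and nonzero imaginary part.\<close>

lemma summable_cesaro_minus: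
  assumes "Re \<alpha> > 0"
  shows "summable (\<lambda>n. cmod (cesaro (- \<alpha>) n))"
proof -
  have "Bseq (rGamma_series (- \<alpha>))"
    by (rule convergent_imp_Bseq) (auto simp: convergent_def intro: rGamma_series_LIMSEQ)
  then obtain K where K: "K > 0" "\<And>n. cmod (rGamma_series (- \<alpha>) n) \<le> K"
    by (auto elim: BseqE)
  have le: "norm (cmod (cesaro (- \<alpha>) (Suc n))) \<le> K * real n powr (- Re \<alpha> - 1)" if "n \<ge> 1" for n
  proof -
    have "pochhammer (- \<alpha>) (Suc n)
        = rGamma_series (- \<alpha>) n * (fact n * exp (- \<alpha> * of_real (ln (of_nat n))))"
      by (simp add: rGamma_series_def)
    then have "cmod (pochhammer (- \<alpha>) (Suc n))
        = cmod (rGamma_series (- \<alpha>) n) * (fact n * real n powr (- Re \<alpha>))"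
      using that by (simp add: norm_mult powr_def)
    then have "cmod (cesaro (- \<alpha>) (Suc n))
        = cmod (rGamma_series (- \<alpha>) n) * real n powr (- Re \<alpha>) / (1 + real n)"
      unfolding cesaro_def norm_divide by (simp add: norm_mult del: of_nat_Suc)
    also have "\<dots> \<le> K * real n powr (- Re \<alpha>) / real n"
      using that K by (intro frac_le mult_right_mono) auto
    also have "\<dots> = K * real n powr (- Re \<alpha> - 1)"
      using that by (simp add: powr_diff)
    finally show ?thesis by simp
  qed
  have "summable (\<lambda>n. K * real n powr (- Re \<alpha> - 1))"
    using assms by (intro summable_mult) (simp add: summable_real_powr_iff)
  then have "summable (\<lambda>n. cmod (cesaro (- \<alpha>) (Suc n)))"
    by (rule summable_comparison_test'[of _ 1]) (rule le)
  then show ?thesis by (simp add: summable_cesaro_Suc_iff)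
qed

lemma l1_norm_cesaro_diff_le:
  assumes "summable (\<lambda>n. cmod (cesaro a n))"
  shows "summable (\<lambda>n. cmod (cesaro (a - 1) n))"
    and "l1_norm (cesaro (a - 1)) \<le> 2 * l1_norm (cesaro a)"
proof -
  have s: "summable (\<lambda>n. cmod (cesaro a (Suc n)))"
    using assms by (simp add: summable_cesaro_Suc_iff)
  have le: "cmod (cesaro (a - 1) (Suc n)) \<le> cmod (cesaro a (Suc n)) + cmod (cesaro a n)" for n
    unfolding cesaro_diff by (rule norm_triangle_ineq4)
  have s': "summable (\<lambda>n. cmod (cesaro (a - 1) (Suc n)))"
    by (rule summable_comparison_test'[OF summable_add[OF s assms], of 0]) (use le in simp)
  then show sum: "summable (\<lambda>n. cmod (cesaro (a - 1) n))" by (simp add: summable_cesaro_Suc_iff)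
  have "(\<Sum>n. cmod (cesaro (a - 1) (Suc n))) \<le> (\<Sum>n. cmod (cesaro a (Suc n)) + cmod (cesaro a n))"
    by (intro suminf_le le s' summable_add s assms)
  also have "\<dots> = (\<Sum>n. cmod (cesaro a (Suc n))) + (\<Sum>n. cmod (cesaro a n))"
    by (rule suminf_add[OF s assms, symmetric])
  finally show "l1_norm (cesaro (a - 1)) \<le> 2 * l1_norm (cesaro a)"
    using suminf_split_head[OF sum] suminf_split_head[OF assms] by (simp add: l1_norm_def)
qed

text \<open>Each unit step of the exponent takes a first difference, which at most doubles the
  \<open>\<ell>\<^sup>1\<close> norm; this is the source of all but one of the factors 2 in \<open>c\<^sub>\<alpha>\<close>.\<close>

lemma l1_norm_cesaro_minus_nat_le:
  assumes "summable (\<lambda>n. cmod (cesaro a n))"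
  shows "summable (\<lambda>n. cmod (cesaro (a - of_nat m) n)) \<and>
    l1_norm (cesaro (a - of_nat m)) \<le> 2 ^ m * l1_norm (cesaro a)"
proof (induction m)
  case (Suc m)
  then show ?case
    using l1_norm_cesaro_diff_le[of "a - of_nat m"]
    by (auto simp: algebra_simps intro: order_trans)
qed (use assms in simp)

lemma Gamma_nonzero_right_half_plane:
  assumes "Re z > 0"
  shows "Gamma z \<noteq> 0"
  using assms by (auto simp: Gamma_eq_zero_iff elim!: nonpos_Ints_cases)

text \<open>Since \<open>cmod (z + n) \<ge> Re z + n\<close> in each factor, the quotient of the two products increases with \<open>n\<close>. By the Gauss product its limit is the
  quotient of the Gamma values, which therefore bounds it.\<close>

lemma cmod_pochhammer_le_Gamma_ratio:
  assumes "Re z > 0"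
  shows "cmod (pochhammer z n)
    \<le> Gamma (Re z) / cmod (Gamma z) * pochhammer (Re z) n"
proof -
  define R where "R n = cmod (pochhammer z n) / pochhammer (Re z) n" for n
  have pos: "pochhammer (Re z) n > 0" for n
    using assms by (rule pochhammer_pos)
  have mono: "incseq R"
  proof (rule incseq_SucI)
    fix n
    have "Re z + real n \<le> cmod (z + of_nat n)"
      using complex_Re_le_cmod[of "z + of_nat n"] by simp
    then have "1 \<le> cmod (z + of_nat n) / (Re z + real n)"
      using assms by (simp add: le_divide_eq)
    then have "R n * 1 \<le> R n * (cmod (z + of_nat n) / (Re z + real n))"
      using pos by (intro mult_left_mono) (auto simp: R_def less_imp_le)
    then show "R n \<le> R (Suc n)"
      by (simp add: R_def pochhammer_Suc norm_mult)
  qed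
  have nz: "Gamma (Re z) \<noteq> 0" "Gamma z \<noteq> 0"
    using assms by (auto simp: Gamma_eq_zero_iff elim!: nonpos_Ints_cases)
  have "(\<lambda>n. cmod (rGamma_series z n) / rGamma_series (Re z) n)
      \<longlonglongrightarrow> cmod (rGamma z) / rGamma (Re z)"
    by (intro tendsto_divide tendsto_norm rGamma_series_LIMSEQ)
      (use nz in \<open>auto simp: rGamma_inverse_Gamma\<close>)
  moreover have "cmod (rGamma_series z n) / rGamma_series (Re z) n = R (Suc n)" for n
    using pos[of "Suc n"]
    by (simp add: rGamma_series_def R_def norm_divide norm_mult)
  moreover have "cmod (rGamma z) / rGamma (Re z) = Gamma (Re z) / cmod (Gamma z)"
    by (simp add: rGamma_inverse_Gamma norm_inverse divide_inverse)
  ultimately have "(\<lambda>n. R (Suc n)) \<longlonglongrightarrow> Gamma (Re z) / cmod (Gamma z)"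
    by simp
  then have "R \<longlonglongrightarrow> Gamma (Re z) / cmod (Gamma z)"
    by (simp add: filterlim_sequentially_Suc)
  then have "R n \<le> Gamma (Re z) / cmod (Gamma z)"
    using mono by (rule incseq_le[rotated])
  then show ?thesis
    using pos[of n] by (simp add: R_def divide_le_eq)
qed

text \<open>For \<open>0 < b < 1\<close> all Cesaro numbers of order \<open>- b\<close> except the first are negative, so their absolute
  values add up by telescoping, to at most 1; the partial sums of \<open>k\<^bsup>-b\<^esup>\<close> are \<open>k\<^bsup>1-b\<^esup>\<close>.\<close>

lemma sum_pochhammer_telescope:
  fixes b :: real
  shows "(\<Sum>n<N. b * pochhammer (1 - b) n / fact (Suc n)) = 1 - pochhammer (1 - b) N / fact N"
proof (induction N)
  case (Suc N)
  have "pochhammer (1 - b) N / fact N - pochhammer (1 - b) (Suc N) / fact (Suc N)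
      = (real (Suc N) - (1 - b + real N)) * pochhammer (1 - b) N / fact (Suc N)"
    by (simp add: pochhammer_Suc divide_simps del: of_nat_Suc) (simp add: algebra_simps)
  also have "\<dots> = b * pochhammer (1 - b) N / fact (Suc N)" by simp
  finally show ?case using Suc by simp
qed simp

text \<open>Comparison with the real exponent \<open>Re \<beta>\<close> costs the factor \<open>cmod \<beta> / Re \<beta>\<close>, from the first factor
  of the Pochhammer symbol, and the Gamma quotient, from the remaining ones. For the real exponent
  the terms with \<open>n \<ge> 1\<close> have total mass at most 1; the term \<open>n = 0\<close> is 1 as well, and both factors are
  at least 1. Hence the constant 2.\<close>

lemma l1_norm_cesaro_le_Gamma:
  assumes "0 < Re \<beta>" "Re \<beta> < 1"
  shows "l1_norm (cesaro (- \<beta>))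
    \<le> 2 * (cmod \<beta> / Re \<beta>) * (Gamma (1 - Re \<beta>) / cmod (Gamma (1 - \<beta>)))"
proof -
  define b where "b = Re \<beta>"
  define G where "G = Gamma (1 - b) / cmod (Gamma (1 - \<beta>))"
  have ratio: "cmod (pochhammer (1 - \<beta>) n) \<le> G * pochhammer (1 - b) n" for n
    using cmod_pochhammer_le_Gamma_ratio[of "1 - \<beta>" n] assms by (simp add: G_def b_def)
  have G: "1 \<le> G" using ratio[of 0] by simp
  have b: "0 < b" "b < 1" "1 \<le> cmod \<beta> / b"
    using assms complex_Re_le_cmod[of \<beta>] by (auto simp: b_def)
  have term_le: "cmod (cesaro (- \<beta>) (Suc n))
      \<le> cmod \<beta> / b * G * (b * pochhammer (1 - b) n / fact (Suc n))" for n
  proof -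
    have "cmod (cesaro (- \<beta>) (Suc n)) = cmod \<beta> * cmod (pochhammer (1 - \<beta>) n) / fact (Suc n)"
      by (simp add: cesaro_def pochhammer_rec norm_mult norm_divide del: fact_Suc)
    also have "\<dots> \<le> cmod \<beta> * (G * pochhammer (1 - b) n) / fact (Suc n)"
      by (intro divide_right_mono mult_left_mono ratio) auto
    finally show ?thesis using b by simp
  qed
  have s: "summable (\<lambda>n. cmod (cesaro (- \<beta>) n))"
    using assms by (intro summable_cesaro_minus)
  have "(\<Sum>n. cmod (cesaro (- \<beta>) (Suc n))) \<le> cmod \<beta> / b * G"
  proof (rule suminf_le_const)
    show "summable (\<lambda>n. cmod (cesaro (- \<beta>) (Suc n)))" using s by (simp add: summable_cesaro_Suc_iff)
    fix N
    have "(\<Sum>n<N. cmod (cesaro (- \<beta>) (Suc n)))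
        \<le> cmod \<beta> / b * G * (\<Sum>n<N. b * pochhammer (1 - b) n / fact (Suc n))"
      unfolding sum_distrib_left by (intro sum_mono term_le)
    also have "\<dots> \<le> cmod \<beta> / b * G * 1"
      unfolding sum_pochhammer_telescope using b G pochhammer_pos[of "1 - b" N]
      by (intro mult_left_mono) auto
    finally show "(\<Sum>n<N. cmod (cesaro (- \<beta>) (Suc n))) \<le> cmod \<beta> / b * G" by simp
  qed
  moreover have "1 * 1 \<le> cmod \<beta> / b * G"
    using b G by (intro mult_mono) auto
  ultimately show ?thesis
    using suminf_split_head[OF s] by (simp add: l1_norm_def G_def b_def)
qed

lemma l1_norm_cesaro_0: "l1_norm (cesaro 0) = 1" and summable_cesaro_0: "summable (\<lambda>n. cmod (cesaro 0 n))"
proof -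
  have "(\<lambda>n. cmod (cesaro 0 n)) sums (\<Sum>n\<in>{0}. cmod (cesaro 0 n))"
    by (rule sums_finite) (auto simp: cesaro_0_left)
  then show "l1_norm (cesaro 0) = 1" "summable (\<lambda>n. cmod (cesaro 0 n))"
    by (auto simp: l1_norm_def sums_iff)
qed

text \<open>Split \<open>\<alpha> = \<beta> + m\<close> with \<open>m\<close> the integer part of \<open>Re \<alpha>\<close>. For \<open>\<beta> = 0\<close> the sequence \<open>k\<^bsup>-\<beta>\<^esup>\<close> is the unit of
  convolution; for \<open>Re \<beta> = 0\<close> and \<open>\<beta> \<noteq> 0\<close> the constant is infinite; the remaining case is the
  estimate by Gamma values.\<close>

lemma l1_norm_cesaro_le_c_const:
  assumes "Re \<alpha> > 0"
  shows "ereal (l1_norm (cesaro (- \<alpha>))) \<le> c_const \<alpha>"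
proof -
  define m where "m = nat \<lfloor>Re \<alpha>\<rfloor>"
  define \<beta> where "\<beta> = \<alpha> - of_nat m"
  have floor: "\<lfloor>Re \<alpha>\<rfloor> = int m" using assms by (simp add: m_def)
  have Re: "0 \<le> Re \<beta>" "Re \<beta> < 1" using floor by (auto simp: \<beta>_def floor_eq_iff)
  have c: "c_const \<alpha> = ereal (2 ^ (m + 1))
       * (if \<beta> = 0 then 1 else ereal (cmod \<beta>) / ereal (Re \<beta>))
       * ereal (Gamma (1 - Re \<beta>) / cmod (Gamma (1 - \<beta>)))"
    unfolding c_const_def Let_def floor by (simp add: \<beta>_def power_int_add)
  have \<alpha>: "- \<alpha> = - \<beta> - of_nat m" by (simp add: \<beta>_def)
  consider "\<beta> = 0" | "\<beta> \<noteq> 0" "Re \<beta> = 0" | "Re \<beta> > 0" using Re by force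
  then show ?thesis
  proof cases
    case 1
    then have "l1_norm (cesaro (- \<alpha>)) \<le> 2 ^ m"
      using l1_norm_cesaro_minus_nat_le[of 0 m] \<alpha>
      by (simp add: l1_norm_cesaro_0 summable_cesaro_0)
    also have "\<dots> \<le> 2 ^ (m + 1)" by simp
    finally show ?thesis using 1 by (simp add: c)
  next
    case 2
    have "Gamma (1 - \<beta>) \<noteq> 0"
      using Re by (intro Gamma_nonzero_right_half_plane) simp
    then have "c_const \<alpha> = \<infinity>" using 2 by (simp add: c)
    then show ?thesis by simp
  next
    case 3
    then have "l1_norm (cesaro (- \<alpha>)) \<le> 2 ^ m * l1_norm (cesaro (- \<beta>))"
      unfolding \<alpha> using l1_norm_cesaro_minus_nat_le summable_cesaro_minus by blast
    also have "\<dots> \<le> 2 ^ m * (2 * (cmod \<beta> / Re \<beta>) * (Gamma (1 - Re \<beta>) / cmod (Gamma (1 - \<beta>))))"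
      using 3 Re by (intro mult_left_mono l1_norm_cesaro_le_Gamma) auto
    also have "\<dots> = 2 ^ (m + 1) * (cmod \<beta> / Re \<beta>) * (Gamma (1 - Re \<beta>) / cmod (Gamma (1 - \<beta>)))"
      by simp
    finally have "ereal (l1_norm (cesaro (- \<alpha>))) \<le> ereal (2 ^ (m + 1) * (cmod \<beta> / Re \<beta>)
        * (Gamma (1 - Re \<beta>) / cmod (Gamma (1 - \<beta>))))"
      by (simp only: ereal_less_eq)
    also have "\<dots> = c_const \<alpha>"
    proof -
      have "(if \<beta> = 0 then 1 else ereal (cmod \<beta>) / ereal (Re \<beta>)) = ereal (cmod \<beta> / Re \<beta>)"
        using 3 by auto
      then show ?thesis by (simp only: c times_ereal.simps)
    qed
    finally show ?thesis .
  qed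
qed

text \<open>The sequence on the left is the \<open>j\<close>-th convolution power of \<open>cesaro a\<close>, and the \<open>\<ell>\<^sup>1\<close> norm is
  submultiplicative.\<close>

lemma l1_norm_cesaro_multiple:
  assumes "summable (\<lambda>n. cmod (cesaro a n))"
  shows "summable (\<lambda>n. cmod (cesaro (of_nat j * a) n)) \<and>
    l1_norm (cesaro (of_nat j * a)) \<le> l1_norm (cesaro a) ^ j"
proof (induction j)
  case 0
  show ?case by (simp add: l1_norm_cesaro_0 summable_cesaro_0)
next
  case (Suc j)
  define f where "f n = (\<Sum>i\<le>n. cmod (cesaro a i) * cmod (cesaro (of_nat j * a) (n - i)))" for n
  have f: "f sums (l1_norm (cesaro a) * l1_norm (cesaro (of_nat j * a)))"
    unfolding f_def l1_norm_def using assms Suc by (intro Cauchy_product_sums) auto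
  have le: "cmod (cesaro (of_nat (Suc j) * a) n) \<le> f n" for n
  proof -
    have "cesaro (of_nat (Suc j) * a) n = (\<Sum>i\<le>n. cesaro a i * cesaro (of_nat j * a) (n - i))"
      unfolding cesaro_convolution by (simp add: algebra_simps)
    then show ?thesis
      unfolding f_def by (auto simp: norm_mult intro!: sum_norm_le)
  qed
  have s: "summable (\<lambda>n. cmod (cesaro (of_nat (Suc j) * a) n))"
    by (rule summable_comparison_test'[of f 0]) (use f le in \<open>auto simp: sums_iff\<close>)
  have "l1_norm (cesaro (of_nat (Suc j) * a)) \<le> suminf f"
    unfolding l1_norm_def by (intro suminf_le le s) (use f in \<open>simp add: sums_iff\<close>)
  also have "\<dots> = l1_norm (cesaro a) * l1_norm (cesaro (of_nat j * a))"
    using f by (simp add: sums_iff)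
  also have "\<dots> \<le> l1_norm (cesaro a) * l1_norm (cesaro a) ^ j"
    using Suc assms by (intro mult_left_mono) (auto simp: l1_norm_def suminf_nonneg)
  finally show ?case using s by simp
qed

section \<open>Falling factorials and the polynomials \<open>p\<^bsub>n;a\<^esub>\<close>\<close>

lemma falling_fact_Suc: "falling_fact z (Suc n) = falling_fact z n * (z - of_nat n)"
  by (simp add: falling_fact_def)

lemma falling_fact_Suc': "falling_fact z (Suc n) = z * falling_fact (z - 1) n"
  unfolding falling_fact_def
  by (subst prod.lessThan_Suc_shift) (simp add: algebra_simps)

lemma cesaro_minus_falling_fact: "cesaro (- z) n = (- 1) ^ n / fact n * falling_fact z n"
proof -
  have "pochhammer (- z) n = (- 1) ^ n * falling_fact z n"
    by (induction n) (simp_all add: falling_fact_def pochhammer_Suc algebra_simps)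
  then show ?thesis by (simp add: cesaro_def)
qed

lemma falling_fact_of_nat_add: "falling_fact (of_nat (j + l)) l * fact j = fact (j + l)"
proof (induction l)
  case (Suc l)
  then show ?case
    unfolding falling_fact_Suc' by (simp add: mult.assoc)
qed (simp add: falling_fact_def)

lemma falling_fact_of_nat_less: "j < l \<Longrightarrow> falling_fact (of_nat j) l = 0"
  by (auto simp: falling_fact_def)

text \<open>The first \<open>l\<close> terms vanish and the others are \<open>s ^ j / fact (j - l)\<close>, a shifted exponential
  series.\<close>

lemma falling_fact_exp_series:
  "(\<lambda>j. s ^ j / fact j * falling_fact (of_nat j) l) sums (s ^ l * exp s)"
proof -
  have "s ^ (j + l) / fact (j + l) * falling_fact (of_nat (j + l)) l = s ^ l * (s ^ j /\<^sub>R fact j)" for j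
    unfolding falling_fact_of_nat_add[of j l, symmetric]
    using falling_fact_of_nat_add[of j l] by (auto simp: power_add scaleR_conv_of_real field_simps)
  moreover have "(\<lambda>j. s ^ l * (s ^ j /\<^sub>R fact j)) sums (s ^ l * exp s)"
    by (intro sums_mult exp_converges)
  ultimately have "(\<lambda>j. s ^ (j + l) / fact (j + l) * falling_fact (of_nat (j + l)) l) sums (s ^ l * exp s)"
    by simp
  then show ?thesis
    by (subst (asm) sums_zero_iff_shift) (simp_all add: falling_fact_of_nat_less)
qed

lemma b_coeff_eq_0: "j = 0 \<or> n < j \<Longrightarrow> b_coeff a j n = 0"
  by (cases n) auto

text \<open>The boundary values in the definition of the array are instances of its recurrence once entries
  outside the triangle are read as 0. The recurrence starts at \<open>n = 1\<close>.\<close>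

lemma b_coeff_Suc:
  assumes "n \<ge> 1"
  shows "b_coeff a j (Suc n) = (a * of_nat j - of_nat n) * b_coeff a j n + a * b_coeff a (j - 1) n"
proof -
  have one: "b_coeff a 1 n = falling_fact a n" using assms by (cases n) auto
  have diag: "b_coeff a n n = a ^ n"
    using assms by (cases n) (auto simp: falling_fact_def)
  consider "j = 0" | "j = 1" | "2 \<le> j" "j \<le> n" | "j = Suc n" "n \<ge> 1" | "j > Suc n"
    using assms by linarith
  then show ?thesis
  proof cases
    case 2
    then show ?thesis using one by (simp add: falling_fact_Suc b_coeff_eq_0)
  next
    case 4
    then show ?thesis using diag by (simp add: b_coeff_eq_0)
  qed (auto simp: b_coeff_eq_0)
qed

text \<open>What the array means: \<open>b\<^bsub>l,n;a\<^esub>\<close> are the coordinates of the polynomial \<open>(z a)\<^sub>n\<close> in the basis of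
  falling factorials of \<open>z\<close>. Multiplying by the next factor and writing
  \<open>z a - n = a (z - l) + (a l - n)\<close> on the \<open>l\<close>-th basis element, one gets the recurrence.\<close>

lemma falling_fact_mult_expansion:
  assumes "n \<ge> 1"
  shows "falling_fact (z * a) n = (\<Sum>l\<le>n. b_coeff a l n * falling_fact z l)"
  using assms
proof (induction n rule: nat_induct_at_least)
  case base
  show ?case by (simp add: falling_fact_def)
next
  case (Suc n)
  have "falling_fact (z * a) (Suc n)
      = (\<Sum>l\<le>n. b_coeff a l n * falling_fact z l * (z * a - of_nat n))"
    by (simp add: falling_fact_Suc Suc.IH sum_distrib_right)
  also have "\<dots> = (\<Sum>l\<le>n. (a * of_nat l - of_nat n) * b_coeff a l n * falling_fact z l)
      + (\<Sum>l\<le>n. a * b_coeff a l n * falling_fact z (Suc l))"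
    unfolding sum.distrib[symmetric]
    by (intro sum.cong refl) (simp add: falling_fact_Suc algebra_simps)
  also have "(\<Sum>l\<le>n. (a * of_nat l - of_nat n) * b_coeff a l n * falling_fact z l)
      = (\<Sum>l\<le>Suc n. (a * of_nat l - of_nat n) * b_coeff a l n * falling_fact z l)"
    by (simp add: b_coeff_eq_0 del: b_coeff.simps)
  also have "(\<Sum>l\<le>n. a * b_coeff a l n * falling_fact z (Suc l))
      = (\<Sum>l\<le>Suc n. a * b_coeff a (l - 1) n * falling_fact z l)"
    by (subst sum.atMost_Suc_shift) (simp add: b_coeff_eq_0 del: b_coeff.simps)
  finally show ?case
    unfolding b_coeff_Suc[OF Suc.hyps] by (simp only: sum.distrib[symmetric] distrib_right)
qed

text \<open>This is a formula of Dobinski type. The summand is a multiple of \<open>(j a)\<^sub>n\<close>; expanding it in falling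
  factorials of \<open>j\<close> and summing each over \<open>j\<close> produces \<open>exp (- t)\<close> times the powers of \<open>- t\<close> in
  \<open>p\<^bsub>n;a\<^esub>\<close>. In other words, \<open>exp (- t) * p\<^bsub>n;a\<^esub>(t)\<close> is the \<open>n\<close>-th coefficient of \<open>exp (- t (1 - z)\<^sup>a)\<close>.\<close>

lemma p_poly_exp_series:
  "(\<lambda>j. (- t) ^ j / fact j * cesaro (of_nat j * - a) n) sums (exp (- t) * p_poly a n t)"
proof (cases "n = 0")
  case True
  then show ?thesis
    using exp_converges[of "- t"] by (simp add: p_poly_def scaleR_conv_of_real divide_inverse_commute)
next
  case False
  have "(\<lambda>j. (- 1) ^ n / fact n * (\<Sum>l\<le>n. b_coeff a l n * ((- t) ^ j / fact j * falling_fact (of_nat j) l)))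
      sums ((- 1) ^ n / fact n * (\<Sum>l\<le>n. b_coeff a l n * ((- t) ^ l * exp (- t))))"
    by (intro sums_mult sums_sum falling_fact_exp_series)
  moreover have "(- 1) ^ n / fact n * (\<Sum>l\<le>n. b_coeff a l n * ((- t) ^ j / fact j * falling_fact (of_nat j) l))
      = (- t) ^ j / fact j * cesaro (of_nat j * - a) n" for j
  proof -
    have "(\<Sum>l\<le>n. b_coeff a l n * ((- t) ^ j / fact j * falling_fact (of_nat j) l))
        = (- t) ^ j / fact j * falling_fact (of_nat j * a) n"
      using False falling_fact_mult_expansion[of n "of_nat j" a]
      by (simp add: sum_distrib_left mult.left_commute)
    then show ?thesis
      using cesaro_minus_falling_fact[of "of_nat j * a" n] by (simp add: mult.commute mult.left_commute)
  qed
  moreover have "(\<Sum>l\<le>n. b_coeff a l n * ((- t) ^ l * exp (- t)))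
      = exp (- t) * (\<Sum>l=1..n. b_coeff a l n * (- t) ^ l)"
  proof -
    have "(\<Sum>l\<le>n. b_coeff a l n * ((- t) ^ l * exp (- t)))
        = (\<Sum>l=1..n. b_coeff a l n * ((- t) ^ l * exp (- t)))"
      by (rule sum.mono_neutral_right) (auto simp: b_coeff_eq_0)
    then show ?thesis by (simp add: sum_distrib_left mult_ac)
  qed
  ultimately show ?thesis using False by (simp add: p_poly_def mult.left_commute)
qed

section \<open>Exponentials of bounded operators\<close>

lemma norm_exp_series_le:
  "norm ((c ^ j / fact j) *\<^sub>C op_pow A j) \<le> (cmod c * norm A) ^ j / fact j"
proof -
  have "cmod (c ^ j / fact j) * norm (op_pow A j) \<le> cmod (c ^ j / fact j) * norm A ^ j"
    by (intro mult_left_mono norm_op_pow_le) simp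
  then show ?thesis
    by (simp add: norm_scaleC norm_divide norm_power power_mult_distrib)
qed

lemma summable_norm_exp_series:
  "summable (\<lambda>j. norm ((c ^ j / fact j) *\<^sub>C op_pow A j))"
  by (rule summable_comparison_test'[OF summable_exp_generic[of "cmod c * norm A"], of 0])
    (simp add: divide_inverse_commute[symmetric] norm_exp_series_le)

lemma op_exp_scaleC:
  assumes "bounded_clinear (blinfun_apply A)"
  shows "op_exp (c *\<^sub>C A) = (\<Sum>j. (c ^ j / fact j) *\<^sub>C op_pow A j)"
  unfolding op_exp_def op_pow_scaleC[OF assms] scaleC_of_real[symmetric]
  by (simp add: scaleC_scaleC)

lemma op_exp_add_scaleC:
  assumes A: "bounded_clinear (blinfun_apply A)"
  shows "op_exp ((s + t) *\<^sub>C A) = op_exp (s *\<^sub>C A) o\<^sub>L op_exp (t *\<^sub>C A)"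
proof -
  have "(\<Sum>i\<le>n. (s ^ i / fact i) * (t ^ (n - i) / fact (n - i))) = (s + t) ^ n / fact n" for n
    unfolding binomial_ring sum_divide_distrib
    by (intro sum.cong refl) (simp add: binomial_fact field_simps)
  then show ?thesis
    using op_series_convolution[OF A summable_norm_exp_series summable_norm_exp_series, of s t]
    by (simp add: op_exp_scaleC[OF A] sums_iff)
qed

lemma op_exp_zero: "op_exp 0 = id_blinfun"
proof -
  have "op_pow (0 :: 'a \<Rightarrow>\<^sub>L 'a) (Suc j) = 0" for j by simp
  then have "(1 / fact j) *\<^sub>R op_pow (0 :: 'a \<Rightarrow>\<^sub>L 'a) j = (if j = 0 then id_blinfun else 0)" for j
    by (cases j) auto
  then show ?thesis
    unfolding op_exp_def by (subst suminf_finite[of "{0}"]) auto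
qed

text \<open>Removing the terms of order 0 and 1 from the exponential series leaves a remainder of size
  \<open>(cmod h)\<^sup>2 * (norm A)\<^sup>2 * exp (cmod h * norm A)\<close>.\<close>

lemma op_exp_derivative_at_zero:
  assumes A: "bounded_clinear (blinfun_apply A)"
  shows "((\<lambda>h. (1 / h) *\<^sub>C (op_exp (h *\<^sub>C A) - id_blinfun)) \<longlongrightarrow> A) (at 0)"
proof -
  have bound: "norm ((1 / h) *\<^sub>C (op_exp (h *\<^sub>C A) - id_blinfun) - A)
      \<le> cmod h * (norm A)\<^sup>2 * exp (cmod h * norm A)" if "h \<noteq> 0" for h
  proof -
    define e where "e j = (h ^ j / fact j) *\<^sub>C op_pow A j" for j
    define r where "r j = (cmod h)\<^sup>2 * (norm A)\<^sup>2 * ((cmod h * norm A) ^ j /\<^sub>R fact j)" for j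
    have r: "r sums ((cmod h)\<^sup>2 * (norm A)\<^sup>2 * exp (cmod h * norm A))"
      unfolding r_def by (intro sums_mult exp_converges)
    have e: "summable (\<lambda>j. norm (e j))" unfolding e_def by (rule summable_norm_exp_series)
    have "norm (e (j + 2)) \<le> r j" for j
    proof -
      have "norm (e (j + 2)) \<le> (cmod h * norm A) ^ (j + 2) / fact (j + 2)"
        unfolding e_def by (rule norm_exp_series_le)
      also have "\<dots> \<le> (cmod h * norm A) ^ (j + 2) / fact j"
        by (intro divide_left_mono fact_mono) auto
      finally show ?thesis by (simp add: r_def power2_eq_square field_simps)
    qed
    then have "norm (\<Sum>j. e (j + 2)) \<le> suminf r"
      using norm_suminf_le[of "\<lambda>j. e (j + 2)" r] r by (auto simp: sums_iff)
    moreover have "op_exp (h *\<^sub>C A) = (\<Sum>j. e (j + 2)) + (\<Sum>j<2. e j)"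
      unfolding op_exp_scaleC[OF A] e_def[symmetric]
      by (rule suminf_split_initial_segment) (use e summable_norm_cancel in blast)
    moreover have "(\<Sum>j<2. e j) = id_blinfun + h *\<^sub>C A"
      by (simp add: e_def numeral_2_eq_2 compose_id_blinfun)
    ultimately have le: "norm (op_exp (h *\<^sub>C A) - id_blinfun - h *\<^sub>C A)
        \<le> (cmod h)\<^sup>2 * (norm A)\<^sup>2 * exp (cmod h * norm A)"
      using r by (simp add: sums_iff)
    have "(1 / h) *\<^sub>C (op_exp (h *\<^sub>C A) - id_blinfun) - A
        = (1 / h) *\<^sub>C (op_exp (h *\<^sub>C A) - id_blinfun - h *\<^sub>C A)"
      using that by (simp add: bounded_bilinear.diff_right[OF bounded_bilinear_scaleC] scaleC_scaleC)
    then have "norm ((1 / h) *\<^sub>C (op_exp (h *\<^sub>C A) - id_blinfun) - A)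
        = norm (op_exp (h *\<^sub>C A) - id_blinfun - h *\<^sub>C A) / cmod h"
      by (simp only: norm_scaleC norm_divide norm_one) simp
    also have "\<dots> \<le> (cmod h)\<^sup>2 * (norm A)\<^sup>2 * exp (cmod h * norm A) / cmod h"
      by (intro divide_right_mono le) simp
    also have "\<dots> = cmod h * (norm A)\<^sup>2 * exp (cmod h * norm A)"
      using that by (simp add: power2_eq_square)
    finally show ?thesis .
  qed
  define u where "u h = cmod h * (norm A)\<^sup>2 * exp (cmod h * norm A)" for h
  have "(u \<longlongrightarrow> cmod 0 * (norm A)\<^sup>2 * exp (cmod 0 * norm A)) (at 0)"
    unfolding u_def by (intro tendsto_intros)
  then have u: "(u \<longlongrightarrow> 0) (at 0)" by simp
  have "\<forall>\<^sub>F h in at 0. norm ((1 / h) *\<^sub>C (op_exp (h *\<^sub>C A) - id_blinfun) - A) \<le> u h"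
    unfolding eventually_at_filter u_def by (rule always_eventually) (use bound in blast)
  then have "((\<lambda>h. (1 / h) *\<^sub>C (op_exp (h *\<^sub>C A) - id_blinfun) - A) \<longlongrightarrow> 0) (at 0)"
    by (rule Lim_null_comparison[OF _ u])
  then show ?thesis by (rule LIM_zero_cancel)
qed

text \<open>By the group law, differentiability at 0 suffices.\<close>

lemma entire_group_op_exp:
  assumes A: "bounded_clinear (blinfun_apply A)"
  shows "entire_group (\<lambda>t. op_exp (t *\<^sub>C A))"
  unfolding entire_group_def
proof (intro conjI allI)
  show "op_exp (0 *\<^sub>C A) = id_blinfun" by (simp add: op_exp_zero)
  show "op_exp ((s + t) *\<^sub>C A) = op_exp (s *\<^sub>C A) o\<^sub>L op_exp (t *\<^sub>C A)" for s t
    by (rule op_exp_add_scaleC[OF A])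
  show "\<exists>D. ((\<lambda>h. (1 / h) *\<^sub>C (op_exp ((t + h) *\<^sub>C A) - op_exp (t *\<^sub>C A))) \<longlongrightarrow> D) (at 0)" for t
  proof
    have "(1 / h) *\<^sub>C (op_exp ((t + h) *\<^sub>C A) - op_exp (t *\<^sub>C A))
        = ((1 / h) *\<^sub>C (op_exp (h *\<^sub>C A) - id_blinfun)) o\<^sub>L op_exp (t *\<^sub>C A)" for h
      unfolding add.commute[of t] op_exp_add_scaleC[OF A] blinfun_compose_scaleC_left
        bounded_bilinear.diff_left[OF bounded_bilinear_blinfun_compose] id_blinfun_compose ..
    then show "((\<lambda>h. (1 / h) *\<^sub>C (op_exp ((t + h) *\<^sub>C A) - op_exp (t *\<^sub>C A)))
        \<longlongrightarrow> A o\<^sub>L op_exp (t *\<^sub>C A)) (at 0)"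
      by (simp add: bounded_bilinear.tendsto[OF bounded_bilinear_blinfun_compose]
          op_exp_derivative_at_zero[OF A])
  qed
qed

section \<open>The fractional power and its exponential\<close>

text \<open>Powers of the fractional power are fractional powers: \<open>((I - T)\<^sup>\<alpha>)\<^sup>j\<close> is the series for the
  exponent \<open>j \<alpha>\<close>. This keeps the constant \<open>power_bound T\<close> from being raised to the power \<open>j\<close> in the
  estimates that follow.\<close>

lemma op_pow_frac_pow_id_minus:
  fixes T :: "'a::complex_banach \<Rightarrow>\<^sub>L 'a"
  assumes "Re \<alpha> > 0" and T: "bounded_clinear (blinfun_apply T)" and "power_bounded T"
  shows "op_pow (frac_pow_id_minus T \<alpha>) j = (\<Sum>n. cesaro (of_nat j * - \<alpha>) n *\<^sub>C op_pow T n)"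
proof (induction j)
  case 0
  have "(\<Sum>n. cesaro 0 n *\<^sub>C op_pow T n) = (\<Sum>n\<in>{0}. cesaro 0 n *\<^sub>C op_pow T n)"
    by (rule suminf_finite) (auto simp: cesaro_0_left)
  then show ?case by simp
next
  case (Suc j)
  have s: "summable (\<lambda>n. norm (cesaro (of_nat i * - \<alpha>) n *\<^sub>C op_pow T n))" for i
    using l1_norm_cesaro_multiple[OF summable_cesaro_minus[OF assms(1)]]
    by (intro summable_scaleC_bounded[OF _ power_bounded_norm_op_pow_le[OF assms(3)]]) blast
  have one: "frac_pow_id_minus T \<alpha> = (\<Sum>n. cesaro (of_nat 1 * - \<alpha>) n *\<^sub>C op_pow T n)"
    by (simp add: frac_pow_id_minus_def)
  have "(\<lambda>n. cesaro (of_nat 1 * - \<alpha> + of_nat j * - \<alpha>) n *\<^sub>C op_pow T n) sums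
      (frac_pow_id_minus T \<alpha> o\<^sub>L op_pow (frac_pow_id_minus T \<alpha>) j)"
    using op_series_convolution[OF T s[of 1] s[of j]]
    unfolding cesaro_convolution one[symmetric] Suc.IH[symmetric] .
  moreover have "of_nat 1 * - \<alpha> + of_nat j * - \<alpha> = of_nat (Suc j) * - \<alpha>"
    by (simp add: algebra_simps)
  ultimately show ?case by (simp only: op_pow.simps sums_unique)
qed

lemma norm_op_pow_frac_pow_id_minus_le:
  fixes T :: "'a::complex_banach \<Rightarrow>\<^sub>L 'a"
  assumes "Re \<alpha> > 0" and "bounded_clinear (blinfun_apply T)" and "power_bounded T"
  shows "norm (op_pow (frac_pow_id_minus T \<alpha>) j) \<le> power_bound T * l1_norm (cesaro (- \<alpha>)) ^ j"
proof -
  have s: "summable (\<lambda>n. cmod (cesaro (of_nat j * - \<alpha>) n))"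
    and le: "l1_norm (cesaro (of_nat j * - \<alpha>)) \<le> l1_norm (cesaro (- \<alpha>)) ^ j"
    using l1_norm_cesaro_multiple[OF summable_cesaro_minus[OF assms(1)], of j] by auto
  have "norm (op_pow (frac_pow_id_minus T \<alpha>) j) \<le> power_bound T * l1_norm (cesaro (of_nat j * - \<alpha>))"
    unfolding op_pow_frac_pow_id_minus[OF assms]
    by (intro norm_suminf_scaleC_le s power_bounded_norm_op_pow_le assms)
  also have "\<dots> \<le> power_bound T * l1_norm (cesaro (- \<alpha>)) ^ j"
    by (intro mult_left_mono le order_trans[OF norm_ge_zero power_bounded_norm_op_pow_le[OF assms(3), of 0]])
  finally show ?thesis .
qed

lemma bounded_clinear_scaleC:
  assumes "bounded_clinear (blinfun_apply F)"
  shows "bounded_clinear (blinfun_apply (c *\<^sub>C F))"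
  unfolding bounded_clinear_def
proof (intro conjI allI)
  show "(c *\<^sub>C F) (d *\<^sub>C x) = d *\<^sub>C (c *\<^sub>C F) x" for d x
    using assms by (simp add: bounded_clinear_def scaleC_blinfun.rep_eq scaleC_scaleC mult.commute)
qed (rule blinfun.bounded_linear_right)

lemma frac_pow_id_minus_summable:
  assumes "Re \<alpha> > 0" and "power_bounded T"
  shows "summable (\<lambda>n. cesaro (- \<alpha>) n *\<^sub>C op_pow T n)"
  by (rule summable_norm_cancel[OF summable_scaleC_bounded[OF summable_cesaro_minus[OF assms(1)]
        power_bounded_norm_op_pow_le[OF assms(2)]]])

lemma bounded_clinear_frac_pow_id_minus:
  assumes "Re \<alpha> > 0" and "bounded_clinear (blinfun_apply T)" and "power_bounded T"
  shows "bounded_clinear (blinfun_apply (frac_pow_id_minus T \<alpha>))"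
  unfolding frac_pow_id_minus_def using assms
  by (intro bounded_clinear_suminf frac_pow_id_minus_summable bounded_clinear_scaleC
      bounded_clinear_op_pow)

lemma norm_op_exp_frac_pow_id_minus_le:
  fixes T :: "'a::complex_banach \<Rightarrow>\<^sub>L 'a"
  assumes "Re \<alpha> > 0" and "bounded_clinear (blinfun_apply T)" and "power_bounded T"
  shows "norm (op_exp (t *\<^sub>C frac_pow_id_minus T \<alpha>))
    \<le> power_bound T * exp (cmod t * l1_norm (cesaro (- \<alpha>)))"
proof -
  define M where "M = l1_norm (cesaro (- \<alpha>))"
  have term_le: "norm ((t ^ j / fact j) *\<^sub>C op_pow (frac_pow_id_minus T \<alpha>) j)
      \<le> power_bound T * ((cmod t * M) ^ j /\<^sub>R fact j)" for j
  proof -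
    have "norm ((t ^ j / fact j) *\<^sub>C op_pow (frac_pow_id_minus T \<alpha>) j)
        \<le> cmod (t ^ j / fact j) * (power_bound T * M ^ j)"
      unfolding norm_scaleC M_def
      by (intro mult_left_mono norm_op_pow_frac_pow_id_minus_le assms) simp
    then show ?thesis
      by (simp add: norm_mult norm_inverse norm_power power_mult_distrib divide_inverse mult_ac)
  qed
  have sum: "(\<lambda>j. power_bound T * ((cmod t * M) ^ j /\<^sub>R fact j)) sums (power_bound T * exp (cmod t * M))"
    by (intro sums_mult exp_converges)
  show ?thesis
    unfolding op_exp_scaleC[OF bounded_clinear_frac_pow_id_minus[OF assms]] M_def[symmetric]
      sums_unique[OF sum]
    by (rule norm_suminf_le[OF term_le sums_summable[OF sum]])
qed

text \<open>Insert the series of all powers of \<open>(I - T)\<^sup>\<alpha>\<close> into the exponential series and collect the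
  coefficient of each \<open>T\<^sup>n\<close>. The double series converges absolutely, since its \<open>j\<close>-th row has
  norm sum at most \<open>power_bound T * (cmod t * l1_norm (cesaro (- \<alpha>))) ^ j / fact j\<close>.\<close>

lemma op_exp_frac_pow_id_minus_series:
  fixes T :: "'a::complex_banach \<Rightarrow>\<^sub>L 'a"
  assumes "Re \<alpha> > 0" and T: "bounded_clinear (blinfun_apply T)" and "power_bounded T"
  shows "summable (\<lambda>n. p_poly \<alpha> n t *\<^sub>C op_pow T n)"
    and "op_exp ((- t) *\<^sub>C frac_pow_id_minus T \<alpha>) = exp (- t) *\<^sub>C (\<Sum>n. p_poly \<alpha> n t *\<^sub>C op_pow T n)"
proof -
  define A where "A = frac_pow_id_minus T \<alpha>"
  define M where "M = l1_norm (cesaro (- \<alpha>))"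
  define C where "C = power_bound T"
  define F where "F j n = ((- t) ^ j / fact j * cesaro (of_nat j * - \<alpha>) n) *\<^sub>C op_pow T n" for j n
  have T_le: "norm (op_pow T n) \<le> C" for n
    unfolding C_def by (intro power_bounded_norm_op_pow_le assms)
  have k: "summable (\<lambda>n. cmod (cesaro (of_nat j * - \<alpha>) n))"
    and k_le: "l1_norm (cesaro (of_nat j * - \<alpha>)) \<le> M ^ j" for j
    using l1_norm_cesaro_multiple[OF summable_cesaro_minus[OF assms(1)], of j] by (auto simp: M_def)
  have F: "F j n = ((- t) ^ j / fact j) *\<^sub>C (cesaro (of_nat j * - \<alpha>) n *\<^sub>C op_pow T n)" for j n
    by (simp add: F_def scaleC_scaleC)
  have inner: "summable (\<lambda>n. norm (F j n))" for j
    unfolding F norm_scaleC[of "_ / _"] by (intro summable_mult summable_scaleC_bounded[OF _ T_le] k)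
  have F_le: "norm (F j n) \<le> cmod t ^ j / fact j * C * cmod (cesaro (of_nat j * - \<alpha>) n)" for j n
  proof -
    have "norm (F j n) = cmod t ^ j / fact j * cmod (cesaro (of_nat j * - \<alpha>) n) * norm (op_pow T n)"
      by (simp add: F_def norm_scaleC norm_mult norm_divide norm_power)
    also have "\<dots> \<le> cmod t ^ j / fact j * cmod (cesaro (of_nat j * - \<alpha>) n) * C"
      by (intro mult_left_mono T_le) auto
    finally show ?thesis by (simp add: mult_ac)
  qed
  have outer: "summable (\<lambda>j. \<Sum>n. norm (F j n))"
  proof (rule summable_comparison_test'[of "\<lambda>j. C * ((cmod t * M) ^ j /\<^sub>R fact j)" 0])
    show "summable (\<lambda>j. C * ((cmod t * M) ^ j /\<^sub>R fact j))"
      by (intro summable_mult summable_exp_generic)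
    fix j
    have "(\<Sum>n. norm (F j n)) \<le> cmod t ^ j / fact j * C * l1_norm (cesaro (of_nat j * - \<alpha>))"
      unfolding l1_norm_def suminf_mult[OF k, symmetric]
      by (intro suminf_le F_le inner summable_mult k)
    also have "\<dots> \<le> cmod t ^ j / fact j * C * M ^ j"
      using order_trans[OF norm_ge_zero T_le] by (intro mult_left_mono k_le) auto
    finally show "norm (\<Sum>n. norm (F j n)) \<le> C * ((cmod t * M) ^ j /\<^sub>R fact j)"
      using suminf_nonneg[OF inner]
      by (simp add: power_mult_distrib divide_inverse_commute mult_ac)
  qed
  have col: "(\<Sum>j. F j n) = exp (- t) *\<^sub>C p_poly \<alpha> n t *\<^sub>C op_pow T n" for n
    unfolding F_def scaleC_scaleC
    by (rule sums_unique[symmetric], rule bounded_linear.sums[OF bounded_linear_scaleC_left p_poly_exp_series])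
  have row: "(\<Sum>n. F j n) = ((- t) ^ j / fact j) *\<^sub>C op_pow A j" for j
    unfolding F A_def op_pow_frac_pow_id_minus[OF assms]
    by (rule bounded_linear.suminf[OF bounded_linear_scaleC
          summable_norm_cancel[OF summable_scaleC_bounded[OF k T_le]], symmetric])
  have "summable (\<lambda>n. exp t *\<^sub>C exp (- t) *\<^sub>C p_poly \<alpha> n t *\<^sub>C op_pow T n)"
    using suminf_swap(1)[OF inner outer] unfolding col
    by (rule bounded_linear.summable[OF bounded_linear_scaleC])
  then show sum: "summable (\<lambda>n. p_poly \<alpha> n t *\<^sub>C op_pow T n)"
    by (simp add: scaleC_scaleC mult.assoc[symmetric] exp_add[symmetric])
  have "op_exp ((- t) *\<^sub>C A) = (\<Sum>j. \<Sum>n. F j n)"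
    unfolding row A_def by (rule op_exp_scaleC[OF bounded_clinear_frac_pow_id_minus[OF assms]])
  also have "\<dots> = (\<Sum>n. exp (- t) *\<^sub>C p_poly \<alpha> n t *\<^sub>C op_pow T n)"
    unfolding suminf_swap(2)[OF inner outer] col ..
  also have "\<dots> = exp (- t) *\<^sub>C (\<Sum>n. p_poly \<alpha> n t *\<^sub>C op_pow T n)"
    by (rule bounded_linear.suminf[OF bounded_linear_scaleC sum, symmetric])
  finally show "op_exp ((- t) *\<^sub>C frac_pow_id_minus T \<alpha>)
      = exp (- t) *\<^sub>C (\<Sum>n. p_poly \<alpha> n t *\<^sub>C op_pow T n)"
    by (simp only: A_def)
qed

theorem corollary5p1:
  fixes T :: "'a::complex_banach \<Rightarrow>\<^sub>L 'a" and \<alpha> :: complex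
  assumes "Re \<alpha> > 0"
    and "bounded_clinear (blinfun_apply T)"
    and "power_bounded T"
  shows
    "(summable (\<lambda>n. cmod (cesaro (- \<alpha>) n)) \<and>
      summable (\<lambda>n. cesaro (- \<alpha>) n *\<^sub>C op_pow T n) \<and>
      bounded_clinear (blinfun_apply (frac_pow_id_minus T \<alpha>)) \<and>
      norm (frac_pow_id_minus T \<alpha>) \<le> power_bound T * l1_norm (cesaro (- \<alpha>)) \<and>
      ereal (power_bound T * l1_norm (cesaro (- \<alpha>))) \<le> c_const \<alpha> * ereal (power_bound T)) \<and>
     (entire_group (\<lambda>t. op_exp ((- t) *\<^sub>C frac_pow_id_minus T \<alpha>)) \<and>
      (\<forall>t. summable (\<lambda>n. p_poly \<alpha> n t *\<^sub>C op_pow T n) \<and>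
        op_exp ((- t) *\<^sub>C frac_pow_id_minus T \<alpha>) =
          exp (- t) *\<^sub>C (\<Sum>n. p_poly \<alpha> n t *\<^sub>C op_pow T n)) \<and>
      (\<forall>c t. c_const \<alpha> = ereal c \<longrightarrow>
        norm (op_exp (t *\<^sub>C frac_pow_id_minus T \<alpha>))
          \<le> power_bound T * exp ((c + 1) * cmod t)))"
proof (intro conjI allI impI)
  have C: "0 \<le> power_bound T"
    using order_trans[OF norm_ge_zero power_bounded_norm_op_pow_le[OF assms(3), of 0]] .
  show "summable (\<lambda>n. cmod (cesaro (- \<alpha>) n))"
    by (rule summable_cesaro_minus[OF assms(1)])
  show "summable (\<lambda>n. cesaro (- \<alpha>) n *\<^sub>C op_pow T n)"
    by (rule frac_pow_id_minus_summable[OF assms(1,3)])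
  show clinear: "bounded_clinear (blinfun_apply (frac_pow_id_minus T \<alpha>))"
    by (rule bounded_clinear_frac_pow_id_minus[OF assms])
  show "norm (frac_pow_id_minus T \<alpha>) \<le> power_bound T * l1_norm (cesaro (- \<alpha>))"
    unfolding frac_pow_id_minus_def
    by (intro norm_suminf_scaleC_le summable_cesaro_minus power_bounded_norm_op_pow_le assms)
  show "ereal (power_bound T * l1_norm (cesaro (- \<alpha>))) \<le> c_const \<alpha> * ereal (power_bound T)"
    using ereal_mult_right_mono[OF l1_norm_cesaro_le_c_const[OF assms(1)], of "ereal (power_bound T)"] C
    by (simp add: mult.commute)
  have "op_exp ((- t) *\<^sub>C frac_pow_id_minus T \<alpha>) = op_exp (t *\<^sub>C - frac_pow_id_minus T \<alpha>)" for t
    by (simp add: scaleC_minus_left bounded_bilinear.minus_right[OF bounded_bilinear_scaleC])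
  moreover have "bounded_clinear (blinfun_apply (- frac_pow_id_minus T \<alpha>))"
    using bounded_clinear_scaleC[OF clinear, of "- 1"] by (simp add: scaleC_minus_left)
  ultimately show "entire_group (\<lambda>t. op_exp ((- t) *\<^sub>C frac_pow_id_minus T \<alpha>))"
    by (simp add: entire_group_op_exp)
  fix t
  show "summable (\<lambda>n. p_poly \<alpha> n t *\<^sub>C op_pow T n)"
    and "op_exp ((- t) *\<^sub>C frac_pow_id_minus T \<alpha>) = exp (- t) *\<^sub>C (\<Sum>n. p_poly \<alpha> n t *\<^sub>C op_pow T n)"
    by (rule op_exp_frac_pow_id_minus_series[OF assms])+
  fix c
  assume "c_const \<alpha> = ereal c"
  then have "l1_norm (cesaro (- \<alpha>)) \<le> c"
    using l1_norm_cesaro_le_c_const[OF assms(1)] by simp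
  then have "power_bound T * exp (cmod t * l1_norm (cesaro (- \<alpha>)))
      \<le> power_bound T * exp ((c + 1) * cmod t)"
    using C by (simp add: mult_left_mono mult.commute[of "cmod t"] mult_right_mono)
  with norm_op_exp_frac_pow_id_minus_le[OF assms, of t]
  show "norm (op_exp (t *\<^sub>C frac_pow_id_minus T \<alpha>)) \<le> power_bound T * exp ((c + 1) * cmod t)"
    by linarith
qed

end
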